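(* Suppose that the mixed-integer bilevel linear program (P0) has a nonempty inducible region $IR$ and that all variables have finite bounds, that $\xi=0$, and that $Y^L$ is finite. Then the projection-based reformulation and decomposition algorithm described in the context converges to the global optimal objective value of (P0) within $|Y^L|$ iterations.
   Context: Data: real vectors $c_R,c_Z,d_R,d_Z,w_R,w_Z$, $r\in\mathbb R^{n_U}$, $s\in\mathbb R^{n_L}$ and real matrices $A_R,A_Z,B_R,B_Z$ (with $n_U$ rows), $Q_R,Q_Z,P_R,P_Z$ (with $n_L$ rows), of compatible sizes. The superscript $t$ denotes transpose, and vector inequalities are componentwise. Upper-level variables are $x^u\in\mathbb R_+^{m_R}$, $y^u\in\mathbb Z_+^{m_Z}$; lower-level variables are $x^l,x^{l0}\in\mathbb R_+^{n_R}$, $y^l,y^{l0}\in\mathbb Z_+^{n_Z}$. (P0) (optimistic bilevel problem): minimize $c_R^tx^u+c_Z^ty^u+d_R^tx^{l0}+d_Z^ty^{l0}$ over $(x^u,y^u,x^{l0},y^{l0})\in\mathbb R_+^{m_R}\times\mathbb Z_+^{m_Z}\times\mathbb R_+^{n_R}\times\mathbb Z_+^{n_Z}$ subject to $A_Rx^u+A_Zy^u+B_Rx^{l0}+B_Zy^{l0}\le r$ and $$(x^{l0},y^{l0})\in\arg\max_{(x^l,y^l)}\{w_R^tx^l+w_Z^ty^l:\ P_Rx^l+P_Zy^l\le s-Q_Rx^u-Q_Zy^u,\ x^l\in\mathbb R_+^{n_R},\ y^l\in\mathbb Z_+^{n_Z}\}.$$ Constraint region: $\Omega$ is the set of $(x^u,y^u,x^{l0},y^{l0})\in\mathbb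 R_+^{m_R}\times\mathbb Z_+^{m_Z}\times\mathbb R_+^{n_R}\times\mathbb Z_+^{n_Z}$ with $A_Rx^u+A_Zy^u+B_Rx^{l0}+B_Zy^{l0}\le r$ and $Q_Rx^u+Q_Zy^u+P_Rx^{l0}+P_Zy^{l0}\le s$. The inducible region $IR$ is the set of $(x^u,y^u,x^{l0},y^{l0})\in\Omega$ such that $(x^{l0},y^{l0})$ belongs to the argmax set displayed above; it is the feasible set of (P0). $Y^L=\mathrm{Proj}_{y^l}\Omega$ is the projection of the constraint region onto the space of lower-level integer variables, i.e. the set of all $y^l\in\mathbb Z_+^{n_Z}$ for which there exists $(x^u,y^u,x^l)\in\mathbb R_+^{m_R}\times\mathbb Z_+^{m_Z}\times\mathbb R_+^{n_R}$ with $(x^u,y^u,x^l,y^l)\in\Omega$ (so both the upper-level and the lower-level constraints are imposed). Its elements are written $y^{l,j}$. For $y^{l,j}\in Y^L$ let $P(y^{l,j})=\{(x^u,y^u,x^l)\in\mathbb R_+^{m_R}\times\mathbb Z_+^{m_Z}\times\mathbb R_+^{n_R}:\ Q_Rx^u+Q_Zy^u+P_Rx^l\le s-P_Zy^{l,j}\}$ and let $\mathrm{Proj}_{(x^u,y^u)}P(y^{l,j})$ be the set of $(x^u,y^u)\in\mathbb R_+^{m_R}\times\mathbb Z_+^{m_Z}$ for which some $x^l\in\mathbb R_+^{n_R}$ satisfies $(x^u,y^u,x^l)\in P(y^{l,j})$. For vectors $a,b$ of the same dimension, $a\perp b$ means that their element-by-element product is zero. Master problem (P5) at iteration $k$, with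 $\underline Y_k^L\subseteq Y^L$: $\Theta_k^*$ is the minimum of $c_R^tx^u+c_Z^ty^u+d_R^tx^{l0}+d_Z^ty^{l0}$ over $(x^u,y^u,x^{l0},y^{l0})\in\Omega$ and $(x^{l,j},\pi^j)$ (one pair for each $y^{l,j}\in\underline Y_k^L$), subject to the following for every $y^{l,j}\in\underline Y_k^L$: if $(x^u,y^u)\in\mathrm{Proj}_{(x^u,y^u)}P(y^{l,j})$, then $w_R^tx^{l0}+w_Z^ty^{l0}\ge w_R^tx^{l,j}+w_Z^ty^{l,j}$; $P_Rx^{l,j}\le s-Q_Rx^u-Q_Zy^u-P_Zy^{l,j}$; $P_R^t\pi^j\ge w_R$; $x^{l,j}\perp(P_R^t\pi^j-w_R)$; $\pi^j\perp(s-Q_Rx^u-Q_Zy^u-P_Rx^{l,j}-P_Zy^{l,j})$; $x^{l,j}\in\mathbb R_+^{n_R}$, $\pi^j\in\mathbb R_+^{n_L}$. Subproblem (P6) at $(x_k^{u,*},y_k^{u,*})$: $\theta_k=\max\{w_R^tx^l+w_Z^ty^l:\ P_Rx^l+P_Zy^l\le s-Q_Rx_k^{u,*}-Q_Zy_k^{u,*},\ x^l\in\mathbb R_+^{n_R},\ y^l\in\mathbb Z_+^{n_Z}\}$. Subproblem (P7) at $(x_k^{u,*},y_k^{u,*})$ and $\theta_k$: $\Theta_{o,k}=\min\{d_R^tx^l+d_Z^ty^l\}$ over $x^l\in\mathbb R_+^{n_R}$, $y^l\in\mathbb Z_+^{n_Z}$ subject to $P_Rx^l+P_Zy^l\le s-Q_Rx_k^{u,*}-Q_Zy_k^{u,*}$,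 $B_Rx^l+B_Zy^l\le r-A_Rx_k^{u,*}-A_Zy_k^{u,*}$, and $w_R^tx^l+w_Z^ty^l\ge\theta_k$. Algorithm, with tolerance $\xi$: Step 1 (initialization): set $LB=-\infty$, $UB=+\infty$, $\xi=0$, $k=0$, $\underline Y_0^L=\varnothing$. Step 2 (lower bounding): solve (P5); denote the optimal solution by $(x_k^{u,*},y_k^{u,*},x_k^{l0,*},y_k^{l0,*})$; set $LB$ to the optimal objective value $\Theta_k^*$. Step 3 (termination): if $UB-LB\le\xi$, terminate and return the optimal solution. Step 4 (subproblem 1): solve (P6) at $(x_k^{u,*},y_k^{u,*})$; denote the optimal solution by $(\hat x_k^l,\hat y_k^l)$ and the optimal objective value by $\theta_k$. Step 5 (subproblem 2): solve (P7) at $(x_k^{u,*},y_k^{u,*})$ and $\theta_k$. If it is feasible, denote the optimal solution by $(x_k^{l,*},y_k^{l,*})$, set $UB=\min\{UB,\ c_R^tx_k^{u,*}+c_Z^ty_k^{u,*}+\Theta_{o,k}\}$ and $\tilde y_k^l=y_k^{l,*}$. If it is infeasible, set $\tilde y_k^l=\hat y_k^l$. Step 6 (tightening the master problem): create new variables $(x^{l,j},\pi^j)$ and the implication displayed in (P5) corresponding to $y^{l,j}=\tilde y_k^l$; set $\underline Y_{k+1}^L=\underline Y_k^L\cup\{\tilde y_k^l\}$ and $k=k+1$. Step 7 (loop): if $UB-LB\le\xi$, terminate and return the optimal solution; otherwise go to Step 2.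
   Formalization: Added assumption: whenever Step 2 is reached, (P5) attains its minimum and the current set of y-vectors lies in Y^L; without either part the claim fails. "Within |Y^L| iterations" means that no iteration with index k > |Y^L| is begun, k starting at 0. *)

theory Defs
  imports "HOL-Analysis.Analysis"
begin

section \<open>Mixed-integer bilevel linear programs\<close>

text \<open>
  The index types \<open>'mr, 'mz\<close> (upper-level continuous and integer variables), \<open>'nr, 'nz\<close>
  (lower-level continuous and integer variables) and \<open>'nu, 'nl\<close> (rows of the upper- and
  lower-level constraints) stand for the dimensions $m_R, m_Z, n_R, n_Z, n_U, n_L$.
\<close>

record ('mr::finite, 'mz::finite, 'nr::finite, 'nz::finite, 'nu::finite, 'nl::finite) miblp =
  c_R :: "real^'mr"
  c_Z :: "real^'mz"
  d_R :: "real^'nr"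
  d_Z :: "real^'nz"
  w_R :: "real^'nr"
  w_Z :: "real^'nz"
  rhs_r :: "real^'nu"
  rhs_s :: "real^'nl"
  A_R :: "real^'mr^'nu"
  A_Z :: "real^'mz^'nu"
  B_R :: "real^'nr^'nu"
  B_Z :: "real^'nz^'nu"
  Q_R :: "real^'mr^'nl"
  Q_Z :: "real^'mz^'nl"
  P_R :: "real^'nr^'nl"
  P_Z :: "real^'nz^'nl"

definition Rplus :: "(real^'n) set" where
  "Rplus = {x. 0 \<le> x}"

text \<open>Integer vectors are real vectors with integral entries; the order on vectors is componentwise.\<close>

definition Zplus :: "(real^'n) set" where
  "Zplus = {y. 0 \<le> y \<and> (\<forall>i. y $ i \<in> \<int>)}"

definition perp :: "real^'n \<Rightarrow> real^'n \<Rightarrow> bool" where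
  "perp a b \<longleftrightarrow> (\<forall>i. a $ i * b $ i = 0)"

text \<open>Points are tuples $(x^u, y^u, x^l, y^l)$.\<close>

type_synonym ('mr, 'mz, 'nr, 'nz) point = "(real^'mr) \<times> (real^'mz) \<times> (real^'nr) \<times> (real^'nz)"

definition upper_obj ::
  "('mr::finite, 'mz::finite, 'nr::finite, 'nz::finite, 'nu::finite, 'nl::finite) miblp
   \<Rightarrow> ('mr, 'mz, 'nr, 'nz) point \<Rightarrow> real" where
  "upper_obj D = (\<lambda>(xu, yu, xl, yl).
     c_R D \<bullet> xu + c_Z D \<bullet> yu + d_R D \<bullet> xl + d_Z D \<bullet> yl)"

definition lower_obj ::
  "('mr::finite, 'mz::finite, 'nr::finite, 'nz::finite, 'nu::finite, 'nl::finite) miblp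
   \<Rightarrow> (real^'nr) \<times> (real^'nz) \<Rightarrow> real" where
  "lower_obj D = (\<lambda>(xl, yl). w_R D \<bullet> xl + w_Z D \<bullet> yl)"

definition lower_feasible ::
  "('mr::finite, 'mz::finite, 'nr::finite, 'nz::finite, 'nu::finite, 'nl::finite) miblp
   \<Rightarrow> real^'mr \<Rightarrow> real^'mz \<Rightarrow> ((real^'nr) \<times> (real^'nz)) set" where
  "lower_feasible D xu yu = {(xl, yl). xl \<in> Rplus \<and> yl \<in> Zplus \<and>
     P_R D *v xl + P_Z D *v yl \<le> rhs_s D - Q_R D *v xu - Q_Z D *v yu}"

definition lower_optimal ::
  "('mr::finite, 'mz::finite, 'nr::finite, 'nz::finite, 'nu::finite, 'nl::finite) miblp
   \<Rightarrow> real^'mr \<Rightarrow> real^'mz \<Rightarrow> (real^'nr) \<times> (real^'nz) \<Rightarrow> bool" where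
  "lower_optimal D xu yu = is_arg_max (lower_obj D) (\<lambda>z. z \<in> lower_feasible D xu yu)"

definition Omega ::
  "('mr::finite, 'mz::finite, 'nr::finite, 'nz::finite, 'nu::finite, 'nl::finite) miblp
   \<Rightarrow> ('mr, 'mz, 'nr, 'nz) point set" where
  "Omega D = {(xu, yu, xl, yl). xu \<in> Rplus \<and> yu \<in> Zplus \<and> xl \<in> Rplus \<and> yl \<in> Zplus \<and>
     A_R D *v xu + A_Z D *v yu + B_R D *v xl + B_Z D *v yl \<le> rhs_r D \<and>
     Q_R D *v xu + Q_Z D *v yu + P_R D *v xl + P_Z D *v yl \<le> rhs_s D}"

definition IR ::
  "('mr::finite, 'mz::finite, 'nr::finite, 'nz::finite, 'nu::finite, 'nl::finite) miblp
   \<Rightarrow> ('mr, 'mz, 'nr, 'nz) point set" where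
  "IR D = {(xu, yu, xl, yl). (xu, yu, xl, yl) \<in> Omega D \<and> lower_optimal D xu yu (xl, yl)}"

definition bilevel_optimal ::
  "('mr::finite, 'mz::finite, 'nr::finite, 'nz::finite, 'nu::finite, 'nl::finite) miblp
   \<Rightarrow> ('mr, 'mz, 'nr, 'nz) point \<Rightarrow> bool" where
  "bilevel_optimal D = is_arg_min (upper_obj D) (\<lambda>p. p \<in> IR D)"

definition YL ::
  "('mr::finite, 'mz::finite, 'nr::finite, 'nz::finite, 'nu::finite, 'nl::finite) miblp
   \<Rightarrow> (real^'nz) set" where
  "YL D = {yl. \<exists>xu yu xl. (xu, yu, xl, yl) \<in> Omega D}"

text \<open>
  The lower-level decision ranges over its own feasible set, which ignores the upper-level
  constraints, so bounds on \<open>Omega D\<close> alone would not bound the variables of the lower-level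
  problem. The set over which the bounds are required contains \<open>Omega D\<close> (take
  \<open>xl = xl0\<close>, \<open>yl = yl0\<close>); all variables are nonnegative, so only upper bounds are needed.
\<close>

definition all_variables_bounded ::
  "('mr::finite, 'mz::finite, 'nr::finite, 'nz::finite, 'nu::finite, 'nl::finite) miblp \<Rightarrow> bool" where
  "all_variables_bounded D \<longleftrightarrow> (\<exists>bxu byu bxl byl. \<forall>xu yu xl0 yl0 xl yl.
     (xu, yu, xl0, yl0) \<in> Omega D \<longrightarrow> (xl, yl) \<in> lower_feasible D xu yu \<longrightarrow>
     xu \<le> bxu \<and> yu \<le> byu \<and> xl \<le> bxl \<and> yl \<le> byl)"

section \<open>Master problem and subproblems\<close>

definition P_set ::
  "('mr::finite, 'mz::finite, 'nr::finite, 'nz::finite, 'nu::finite, 'nl::finite) miblp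
   \<Rightarrow> real^'nz \<Rightarrow> ((real^'mr) \<times> (real^'mz) \<times> (real^'nr)) set" where
  "P_set D y = {(xu, yu, xl). xu \<in> Rplus \<and> yu \<in> Zplus \<and> xl \<in> Rplus \<and>
     Q_R D *v xu + Q_Z D *v yu + P_R D *v xl \<le> rhs_s D - P_Z D *v y}"

definition Proj_P ::
  "('mr::finite, 'mz::finite, 'nr::finite, 'nz::finite, 'nu::finite, 'nl::finite) miblp
   \<Rightarrow> real^'nz \<Rightarrow> ((real^'mr) \<times> (real^'mz)) set" where
  "Proj_P D y = {(xu, yu). \<exists>xl. (xu, yu, xl) \<in> P_set D y}"

text \<open>The variables $x^{l,j}, \pi^j$ are the values at \<open>y\<close> of two functions \<open>xj\<close> and \<open>\<pi>\<close>.\<close>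

definition master_feasible ::
  "('mr::finite, 'mz::finite, 'nr::finite, 'nz::finite, 'nu::finite, 'nl::finite) miblp
   \<Rightarrow> (real^'nz) set
   \<Rightarrow> (('mr, 'mz, 'nr, 'nz) point \<times> (real^'nz \<Rightarrow> real^'nr) \<times> (real^'nz \<Rightarrow> real^'nl)) set" where
  "master_feasible D Ys = {((xu, yu, xl0, yl0), xj, \<pi>). (xu, yu, xl0, yl0) \<in> Omega D \<and>
     (\<forall>y\<in>Ys. (xu, yu) \<in> Proj_P D y \<longrightarrow>
        w_R D \<bullet> xl0 + w_Z D \<bullet> yl0 \<ge> w_R D \<bullet> xj y + w_Z D \<bullet> y \<and>
        P_R D *v xj y \<le> rhs_s D - Q_R D *v xu - Q_Z D *v yu - P_Z D *v y \<and>
        transpose (P_R D) *v \<pi> y \<ge> w_R D \<and>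
        perp (xj y) (transpose (P_R D) *v \<pi> y - w_R D) \<and>
        perp (\<pi> y) (rhs_s D - Q_R D *v xu - Q_Z D *v yu - P_R D *v xj y - P_Z D *v y) \<and>
        xj y \<in> Rplus \<and> \<pi> y \<in> Rplus)}"

text \<open>
  The master problem is posed only for sets \<open>Ys\<close> of elements of \<open>YL D\<close>. This is a genuine
  restriction: the point added when the second subproblem is infeasible need not satisfy the upper-level
  constraints for any upper-level decision.
\<close>

definition master_optimal ::
  "('mr::finite, 'mz::finite, 'nr::finite, 'nz::finite, 'nu::finite, 'nl::finite) miblp
   \<Rightarrow> (real^'nz) set
   \<Rightarrow> ('mr, 'mz, 'nr, 'nz) point \<times> (real^'nz \<Rightarrow> real^'nr) \<times> (real^'nz \<Rightarrow> real^'nl) \<Rightarrow> bool" where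
  "master_optimal D Ys z \<longleftrightarrow> Ys \<subseteq> YL D \<and>
     is_arg_min (\<lambda>z. upper_obj D (fst z)) (\<lambda>z. z \<in> master_feasible D Ys) z"

definition sub2_feasible ::
  "('mr::finite, 'mz::finite, 'nr::finite, 'nz::finite, 'nu::finite, 'nl::finite) miblp
   \<Rightarrow> real^'mr \<Rightarrow> real^'mz \<Rightarrow> real \<Rightarrow> ((real^'nr) \<times> (real^'nz)) set" where
  "sub2_feasible D xu yu \<theta> = {(xl, yl). xl \<in> Rplus \<and> yl \<in> Zplus \<and>
     P_R D *v xl + P_Z D *v yl \<le> rhs_s D - Q_R D *v xu - Q_Z D *v yu \<and>
     B_R D *v xl + B_Z D *v yl \<le> rhs_r D - A_R D *v xu - A_Z D *v yu \<and>
     w_R D \<bullet> xl + w_Z D \<bullet> yl \<ge> \<theta>}"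

definition sub2_optimal ::
  "('mr::finite, 'mz::finite, 'nr::finite, 'nz::finite, 'nu::finite, 'nl::finite) miblp
   \<Rightarrow> real^'mr \<Rightarrow> real^'mz \<Rightarrow> real \<Rightarrow> (real^'nr) \<times> (real^'nz) \<Rightarrow> bool" where
  "sub2_optimal D xu yu \<theta> = is_arg_min (\<lambda>(xl, yl). d_R D \<bullet> xl + d_Z D \<bullet> yl)
     (\<lambda>z. z \<in> sub2_feasible D xu yu \<theta>)"

section \<open>The decomposition algorithm as a transition system\<close>

datatype control = Step2 | Step3 | Step4 | Step5 | Step6 | Step7 | Terminated

record ('mr::finite, 'mz::finite, 'nr::finite, 'nz::finite) alg_state =
  ctrl :: control
  iter :: nat
  lower_bd :: ereal
  upper_bd :: ereal
  Y_under :: "(real^'nz) set"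
  xu_star :: "real^'mr"
  yu_star :: "real^'mz"
  xl0_star :: "real^'nr"
  yl0_star :: "real^'nz"
  y_hat :: "real^'nz"
  theta :: real
  y_tilde :: "real^'nz"

text \<open>Step 1. The components not mentioned are written before they are first read.\<close>

definition initial_state ::
  "('mr::finite, 'mz::finite, 'nr::finite, 'nz::finite) alg_state \<Rightarrow> bool" where
  "initial_state st \<longleftrightarrow> ctrl st = Step2 \<and> iter st = 0 \<and>
     lower_bd st = -\<infinity> \<and> upper_bd st = \<infinity> \<and> Y_under st = {}"

text \<open>
  The relation is nondeterministic, since every problem may have several optimal solutions.
  The first subproblem is the lower-level problem itself at the current upper-level decision.
\<close>

inductive alg_step ::
  "('mr::finite, 'mz::finite, 'nr::finite, 'nz::finite, 'nu::finite, 'nl::finite) miblp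
   \<Rightarrow> real \<Rightarrow> ('mr, 'mz, 'nr, 'nz) alg_state \<Rightarrow> ('mr, 'mz, 'nr, 'nz) alg_state \<Rightarrow> bool"
  for D \<xi> where
  solve_master:
    "\<lbrakk>ctrl st = Step2; master_optimal D (Y_under st) ((xu, yu, xl0, yl0), xj, \<pi>)\<rbrakk> \<Longrightarrow>
     alg_step D \<xi> st (st\<lparr>ctrl := Step3, lower_bd := ereal (upper_obj D (xu, yu, xl0, yl0)),
       xu_star := xu, yu_star := yu, xl0_star := xl0, yl0_star := yl0\<rparr>)"
| stop3:
    "\<lbrakk>ctrl st = Step3; upper_bd st - lower_bd st \<le> ereal \<xi>\<rbrakk> \<Longrightarrow>
     alg_step D \<xi> st (st\<lparr>ctrl := Terminated\<rparr>)"
| continue3: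
    "\<lbrakk>ctrl st = Step3; \<not> upper_bd st - lower_bd st \<le> ereal \<xi>\<rbrakk> \<Longrightarrow>
     alg_step D \<xi> st (st\<lparr>ctrl := Step4\<rparr>)"
| subproblem1:
    "\<lbrakk>ctrl st = Step4; lower_optimal D (xu_star st) (yu_star st) (xl, yl)\<rbrakk> \<Longrightarrow>
     alg_step D \<xi> st (st\<lparr>ctrl := Step5, y_hat := yl, theta := lower_obj D (xl, yl)\<rparr>)"
| subproblem2_feasible:
    "\<lbrakk>ctrl st = Step5; sub2_optimal D (xu_star st) (yu_star st) (theta st) (xl, yl)\<rbrakk> \<Longrightarrow>
     alg_step D \<xi> st (st\<lparr>ctrl := Step6,
       upper_bd := min (upper_bd st) (ereal (c_R D \<bullet> xu_star st + c_Z D \<bullet> yu_star st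
                                             + (d_R D \<bullet> xl + d_Z D \<bullet> yl))),
       y_tilde := yl\<rparr>)"
| subproblem2_infeasible:
    "\<lbrakk>ctrl st = Step5; sub2_feasible D (xu_star st) (yu_star st) (theta st) = {}\<rbrakk> \<Longrightarrow>
     alg_step D \<xi> st (st\<lparr>ctrl := Step6, y_tilde := y_hat st\<rparr>)"
| tighten:
    "ctrl st = Step6 \<Longrightarrow>
     alg_step D \<xi> st (st\<lparr>ctrl := Step7, Y_under := insert (y_tilde st) (Y_under st),
       iter := Suc (iter st)\<rparr>)"
| stop7:
    "\<lbrakk>ctrl st = Step7; upper_bd st - lower_bd st \<le> ereal \<xi>\<rbrakk> \<Longrightarrow>
     alg_step D \<xi> st (st\<lparr>ctrl := Terminated\<rparr>)"
| loop7:
    "\<lbrakk>ctrl st = Step7; \<not> upper_bd st - lower_bd st \<le> ereal \<xi>\<rbrakk> \<Longrightarrow>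
     alg_step D \<xi> st (st\<lparr>ctrl := Step2\<rparr>)"

text \<open>
  Maximal executions, as infinite sequences: a state without successor is repeated forever.
  Such a state is either terminated or has an unsolvable problem at its current step.
\<close>

definition alg_run ::
  "('mr::finite, 'mz::finite, 'nr::finite, 'nz::finite, 'nu::finite, 'nl::finite) miblp
   \<Rightarrow> real \<Rightarrow> (nat \<Rightarrow> ('mr, 'mz, 'nr, 'nz) alg_state) \<Rightarrow> bool" where
  "alg_run D \<xi> st \<longleftrightarrow> initial_state (st 0) \<and>
     (\<forall>n. alg_step D \<xi> (st n) (st (Suc n)) \<or>
          (\<nexists>t. alg_step D \<xi> (st n) t) \<and> st (Suc n) = st n)"

end

theory Submission imports Defs begin

text \<open>
  The master problem is a relaxation of the bilevel problem, and each of its cuts is exact: once an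
  integer vector \<open>y\<close> belongs to \<open>Y_under\<close>, the lower-level part of a master solution is at
  least as good for the follower as anything reachable with \<open>y\<close>. Both facts come from linear
  programming. For fixed upper-level decision and fixed \<open>y\<close>, the follower faces a linear program
  in \<open>xl\<close>, and the complementarity system in the cut says that \<open>xj y\<close> solves it. Weak
  duality (\<open>KKT_imp_optimal\<close>) makes the cut exact (\<open>master_cut\<close>). Strong duality
  (\<open>optimal_imp_KKT\<close>), together with the attainment of the optimum on a bounded feasible set, shows
  that every point of the inducible region extends to a feasible point of the master problem
  (\<open>IR_extends_to_master\<close>), so the lower bound is valid. The upper bound is the value of a point
  of the inducible region, because a feasible point of the second subproblem is a follower optimum
  that respects the upper-level constraints (\<open>sub2_feasible_imp_IR\<close>). Hence a closed gap means
  that both bounds equal the optimal value.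

  For the iteration count, suppose that the vector to be added is already in \<open>Y_under\<close>. It
  comes from a response whose follower value is at least the optimum \<open>\<theta>\<close>. By exactness of its
  cut, the follower value of the master solution is at least \<open>\<theta>\<close>, so the master solution itself is feasible for the second subproblem (\<open>repeated_cut_feasible\<close>). The
  subproblem is therefore feasible, and its value pulls the upper bound down to the lower bound: the
  gap closes. As long as the gap is open, each iteration thus adds a new element to
  \<open>Y_under\<close>, and every set for which the master problem is solved lies in \<open>YL D\<close>, so the
  number of iterations is at most \<open>card (YL D)\<close>.

  These facts are organised as an invariant of the transition system (\<open>alg_invariant\<close>). The
  execution does not get stuck, because the subproblems attain their optima by compactness
  (\<open>alg_step_exists\<close>), and it does not go on forever, because a counter increases by one with every
  step between bounded values (\<open>alg_step_progress\<close>, \<open>progress_bound\<close>).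
\<close>

section \<open>Optimality conditions for linear programs\<close>

text \<open>
  This is Farkas' lemma. A finitely generated cone is closed, so a hyperplane strictly separates it
  from \<open>w\<close>; as the cone is invariant under scaling, a linear functional that is bounded below on it
  is nonnegative on it.
\<close>

lemma convex_cone_hull_separation:
  fixes w :: "'a::euclidean_space"
  assumes "finite S" and "w \<notin> convex_cone hull S"
  obtains d where "0 < d \<bullet> w" and "\<And>x. x \<in> S \<Longrightarrow> d \<bullet> x \<le> 0"
proof -
  have "closed (convex_cone hull S)"
    using assms(1) by (rule closed_convex_cone_hull)
  then obtain a b where az: "a \<bullet> w < b" and ab: "\<And>x. x \<in> convex_cone hull S \<Longrightarrow> b < a \<bullet> x"
    using separating_hyperplane_closed_point[OF convex_convex_cone_hull _ assms(2)] by blast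
  have b: "b < 0"
    using ab[OF convex_cone_hull_contains_0] by simp
  have "0 \<le> a \<bullet> x" if x: "x \<in> S" for x
  proof (rule ccontr)
    assume neg: "\<not> 0 \<le> a \<bullet> x"
    \<comment> \<open>This multiple of \<open>x\<close> lies exactly on the separating hyperplane.\<close>
    have "(b / (a \<bullet> x)) *\<^sub>R x \<in> convex_cone hull S"
      using neg b x by (intro convex_cone_hull_mul hull_inc) (auto simp: zero_le_divide_iff)
    from ab[OF this] show False
      using neg by simp
  qed
  moreover have "0 < (- a) \<bullet> w"
    using az b by simp
  ultimately show ?thesis
    using that[of "- a"] by simp
qed

text \<open>
  A constraint that is slack at the current point survives any sufficiently small step; only tight
  constraints restrict the direction of the step.
\<close>

lemma eventually_feasible_direction:
  fixes a b c :: real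
  assumes "a \<le> b" and "a = b \<Longrightarrow> c \<le> 0"
  shows "\<forall>\<^sub>F e in at_right 0. a + e * c \<le> b"
proof (cases "a = b")
  case True
  have "\<forall>\<^sub>F e in at_right (0::real). 0 < e"
    by (simp add: eventually_at_right_less)
  then show ?thesis
    by eventually_elim (use assms(2) True in \<open>simp add: mult_nonneg_nonpos\<close>)
next
  case False
  have "((\<lambda>e. a + e * c) \<longlongrightarrow> a + 0 * c) (at_right 0)"
    by (intro tendsto_intros)
  then have "\<forall>\<^sub>F e in at_right 0. a + e * c < b"
    using False assms(1) by (intro order_tendstoD(2)[where y = "a + 0 * c"]) auto
  then show ?thesis
    by eventually_elim simp
qed

text \<open>
  The optimality system, with multiplier \<open>\<pi>\<close>, of the linear program that maximises
  \<open>w \<bullet> x\<close> subject to \<open>P *v x \<le> b\<close> and \<open>0 \<le> x\<close>.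
\<close>

definition KKT :: "real^'n^'m \<Rightarrow> real^'m \<Rightarrow> real^'n \<Rightarrow> real^'n \<Rightarrow> real^'m \<Rightarrow> bool" where
  "KKT P b w x \<pi> \<longleftrightarrow> 0 \<le> x \<and> P *v x \<le> b \<and> 0 \<le> \<pi> \<and> w \<le> transpose P *v \<pi> \<and>
     perp x (transpose P *v \<pi> - w) \<and> perp \<pi> (b - P *v x)"

lemma perp_imp_inner_eq_0: "perp x y \<Longrightarrow> x \<bullet> y = 0"
  unfolding perp_def inner_vec_def by (intro sum.neutral) simp

lemma inner_mono_nonneg:
  fixes x y z :: "real^'n"
  assumes "x \<le> y" and "0 \<le> z"
  shows "x \<bullet> z \<le> y \<bullet> z"
  using assms by (auto simp: inner_vec_def less_eq_vec_def intro!: sum_mono mult_right_mono)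

text \<open>
  Weak duality: the dual value \<open>b \<bullet> \<pi>\<close> bounds every primal value, and the two
  complementarity conditions say that \<open>x\<close> attains it.
\<close>

lemma KKT_imp_optimal:
  assumes "KKT P b w x \<pi>" and "0 \<le> x'" and "P *v x' \<le> b"
  shows "w \<bullet> x' \<le> w \<bullet> x"
proof -
  have "w \<bullet> x' \<le> (transpose P *v \<pi>) \<bullet> x'"
    using assms by (intro inner_mono_nonneg) (auto simp: KKT_def)
  also have "\<dots> = (P *v x') \<bullet> \<pi>"
    by (simp add: dot_lmul_matrix[symmetric] inner_commute)
  also have "\<dots> \<le> b \<bullet> \<pi>"
    using assms by (intro inner_mono_nonneg) (auto simp: KKT_def)
  also have "\<dots> = (P *v x) \<bullet> \<pi>"
    using assms(1) by (auto simp: KKT_def inner_diff_right inner_commute dest!: perp_imp_inner_eq_0)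
  also have "\<dots> = (transpose P *v \<pi>) \<bullet> x"
    by (simp add: dot_lmul_matrix[symmetric] inner_commute)
  also have "\<dots> = w \<bullet> x"
    using assms(1) by (auto simp: KKT_def inner_diff_right inner_commute dest!: perp_imp_inner_eq_0)
  finally show ?thesis .
qed

text \<open>
  Strong duality. The objective vector lies in the cone generated by the outer normals of the
  constraints that are tight at \<open>x\<close>; otherwise Farkas' lemma gives a direction that improves the
  objective and violates no constraint for a short step. The coefficients of the objective vector in
  this cone are the multipliers: \<open>\<pi>\<close> for the rows of \<open>P\<close>, and \<open>\<sigma>\<close> for the
  sign constraints.
\<close>

lemma optimal_imp_KKT:
  fixes P :: "real^'n^'m"
  assumes x: "0 \<le> x" "P *v x \<le> b"
    and opt: "\<And>x'. 0 \<le> x' \<Longrightarrow> P *v x' \<le> b \<Longrightarrow> w \<bullet> x' \<le> w \<bullet> x"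
  obtains \<pi> where "KKT P b w x \<pi>"
proof -
  \<comment> \<open>\<open>S\<close> holds the normals of the tight constraints, and \<open>C\<close> describes the cone that they
    generate in terms of multipliers.\<close>
  define S where "S = (\<lambda>i. P $ i) ` {i. (P *v x) $ i = b $ i} \<union>
    (\<lambda>j. - axis j 1) ` {j. x $ j = 0}"
  define C where "C = {transpose P *v \<pi> - \<sigma> | \<pi> \<sigma>.
    0 \<le> \<pi> \<and> 0 \<le> \<sigma> \<and> perp \<pi> (b - P *v x) \<and> perp x \<sigma>}"
  have "w \<in> convex_cone hull S"
  proof (rule ccontr)
    assume "w \<notin> convex_cone hull S"
    moreover have "finite S"
      by (simp add: S_def)
    ultimately obtain d where dw: "0 < d \<bullet> w" and dS: "\<And>v. v \<in> S \<Longrightarrow> d \<bullet> v \<le> 0"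
      using convex_cone_hull_separation by blast
    have tight: "(P *v d) $ i \<le> 0" if "(P *v x) $ i = b $ i" for i
      using dS[of "P $ i"] that
      by (auto simp: S_def matrix_vector_mul_component inner_commute)
    have zero: "0 \<le> d $ j" if "x $ j = 0" for j
      using dS[of "- axis j 1"] that by (auto simp: S_def inner_axis)
    have "\<forall>\<^sub>F e in at_right (0::real). \<forall>i. (P *v x) $ i + e * (P *v d) $ i \<le> b $ i"
      using x tight
      by (intro eventually_all_finite eventually_feasible_direction) (auto simp: less_eq_vec_def)
    moreover have "\<forall>\<^sub>F e in at_right (0::real). \<forall>j. - x $ j + e * (- d $ j) \<le> 0"
      using x zero
      by (intro eventually_all_finite eventually_feasible_direction) (auto simp: less_eq_vec_def)
    moreover have "\<forall>\<^sub>F e in at_right (0::real). 0 < e"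
      by (simp add: eventually_at_right_less)
    ultimately have "\<forall>\<^sub>F e in at_right (0::real). False"
    proof eventually_elim
      case (elim e)
      have "0 \<le> x + e *\<^sub>R d"
        unfolding less_eq_vec_def
      proof
        fix j
        show "0 $ j \<le> (x + e *\<^sub>R d) $ j"
          using elim(2)[rule_format, of j] by simp
      qed
      moreover have "P *v (x + e *\<^sub>R d) \<le> b"
        using elim(1)
        by (simp add: less_eq_vec_def matrix_vector_right_distrib matrix_vector_mult_scaleR)
      ultimately have "w \<bullet> (x + e *\<^sub>R d) \<le> w \<bullet> x"
        by (rule opt)
      then show False
        using dw elim(3) by (simp add: inner_add_right inner_commute mult_le_0_iff)
    qed
    then show False
      by simp
  qed
  also have "convex_cone hull S \<subseteq> C"
  proof (rule hull_minimal)
    show "S \<subseteq> C"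
    proof
      fix v assume "v \<in> S"
      then consider i where "v = P $ i" "(P *v x) $ i = b $ i"
        | j where "v = - axis j 1" "x $ j = 0"
        by (auto simp: S_def)
      then show "v \<in> C"
      proof cases
        case 1
        have "v = transpose P *v axis i 1 - 0"
          using 1 by (simp add: matrix_vector_mult_basis row_def vec_eq_iff del: transpose_matrix_vector)
        moreover have "0 \<le> (axis i 1 :: real^'m)" "perp (axis i 1) (b - P *v x)" "perp x 0"
          using 1 by (auto simp: less_eq_vec_def axis_def perp_def)
        ultimately show ?thesis
          unfolding C_def by blast
      next
        case 2
        have "v = transpose P *v 0 - axis j 1"
          using 2 by simp
        moreover have "0 \<le> (axis j 1 :: real^'n)" "perp 0 (b - P *v x)" "perp x (axis j 1)"
          using 2 by (auto simp: less_eq_vec_def axis_def perp_def)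
        ultimately show ?thesis
          unfolding C_def by blast
      qed
    qed
    have "0 \<in> C"
      unfolding C_def by (force simp: perp_def intro: exI[of _ 0])
    moreover have "u + v \<in> C" if uv: "u \<in> C" "v \<in> C" for u v
    proof -
      from uv obtain \<pi> \<sigma> \<pi>' \<sigma>' where
        "u = transpose P *v \<pi> - \<sigma>" "v = transpose P *v \<pi>' - \<sigma>'"
        "0 \<le> \<pi>" "0 \<le> \<sigma>" "perp \<pi> (b - P *v x)" "perp x \<sigma>"
        "0 \<le> \<pi>'" "0 \<le> \<sigma>'" "perp \<pi>' (b - P *v x)" "perp x \<sigma>'"
        unfolding C_def by blast
      then have "u + v = transpose P *v (\<pi> + \<pi>') - (\<sigma> + \<sigma>') \<and> 0 \<le> \<pi> + \<pi>' \<and> 0 \<le> \<sigma> + \<sigma>' \<and>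
          perp (\<pi> + \<pi>') (b - P *v x) \<and> perp x (\<sigma> + \<sigma>')"
        by (auto simp add: matrix_vector_right_distrib perp_def distrib_left distrib_right
            simp del: transpose_matrix_vector) (metis add_0 mult_eq_0_iff right_minus_eq)+
      then show ?thesis
        unfolding C_def by blast
    qed
    moreover have "c *\<^sub>R v \<in> C" if v: "v \<in> C" and c: "0 \<le> c" for c v
    proof -
      from v obtain \<pi> \<sigma> where "v = transpose P *v \<pi> - \<sigma>"
        "0 \<le> \<pi>" "0 \<le> \<sigma>" "perp \<pi> (b - P *v x)" "perp x \<sigma>"
        unfolding C_def by blast
      then have "c *\<^sub>R v = transpose P *v (c *\<^sub>R \<pi>) - (c *\<^sub>R \<sigma>) \<and> 0 \<le> c *\<^sub>R \<pi> \<and>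
          0 \<le> c *\<^sub>R \<sigma> \<and> perp (c *\<^sub>R \<pi>) (b - P *v x) \<and> perp x (c *\<^sub>R \<sigma>)"
        using c by (auto simp add: matrix_vector_mult_scaleR perp_def scaleR_diff_right
            less_eq_vec_def simp del: transpose_matrix_vector)
      then show ?thesis
        unfolding C_def by blast
    qed
    ultimately show "convex_cone C"
      by (auto simp: convex_cone_iff)
  qed
  finally obtain \<pi> \<sigma> where "w = transpose P *v \<pi> - \<sigma>"
    "0 \<le> \<pi>" "0 \<le> \<sigma>" "perp \<pi> (b - P *v x)" "perp x \<sigma>"
    unfolding C_def by blast
  then have "KKT P b w x \<pi>"
    using x by (auto simp: KKT_def)
  then show ?thesis
    by (rule that)
qed

section \<open>Feasible sets of the master problem and the subproblems\<close>

lemma master_feasible_iff: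
  "((xu, yu, xl0, yl0), xj, \<pi>) \<in> master_feasible D Ys \<longleftrightarrow>
     (xu, yu, xl0, yl0) \<in> Omega D \<and>
     (\<forall>y\<in>Ys. (xu, yu) \<in> Proj_P D y \<longrightarrow>
        lower_obj D (xj y, y) \<le> lower_obj D (xl0, yl0) \<and>
        KKT (P_R D) (rhs_s D - Q_R D *v xu - Q_Z D *v yu - P_Z D *v y) (w_R D) (xj y) (\<pi> y))"
proof -
  have reorder: "rhs_s D - Q_R D *v xu - Q_Z D *v yu - P_R D *v xj y - P_Z D *v y =
      rhs_s D - Q_R D *v xu - Q_Z D *v yu - P_Z D *v y - P_R D *v xj y" for y
    by simp
  then show ?thesis
    by (auto simp: master_feasible_def KKT_def lower_obj_def Rplus_def reorder
        simp del: transpose_matrix_vector)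
qed

lemma lower_feasible_iff:
  "(xl, yl) \<in> lower_feasible D xu yu \<longleftrightarrow> yl \<in> Zplus \<and> 0 \<le> xl \<and>
     P_R D *v xl \<le> rhs_s D - Q_R D *v xu - Q_Z D *v yu - P_Z D *v yl"
  by (auto simp: lower_feasible_def Rplus_def algebra_simps)

lemma Proj_P_iff:
  assumes "xu \<in> Rplus" "yu \<in> Zplus" "y \<in> Zplus"
  shows "(xu, yu) \<in> Proj_P D y \<longleftrightarrow> (\<exists>xl. (xl, y) \<in> lower_feasible D xu yu)"
  using assms by (auto simp: Proj_P_def P_set_def lower_feasible_iff Rplus_def algebra_simps)

lemma Omega_iff:
  assumes "xu \<in> Rplus" "yu \<in> Zplus"
  shows "(xu, yu, xl, yl) \<in> Omega D \<longleftrightarrow> (xl, yl) \<in> lower_feasible D xu yu \<and>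
    B_R D *v xl + B_Z D *v yl \<le> rhs_r D - A_R D *v xu - A_Z D *v yu"
  using assms by (auto simp: Omega_def lower_feasible_def algebra_simps)

lemma Omega_signs:
  assumes "(xu, yu, xl, yl) \<in> Omega D"
  shows "xu \<in> Rplus" "yu \<in> Zplus" "yl \<in> Zplus" "(xl, yl) \<in> lower_feasible D xu yu"
  using assms by (auto simp: Omega_def lower_feasible_def algebra_simps)

lemma YL_subset_Zplus: "YL D \<subseteq> Zplus"
  by (auto simp: YL_def Omega_def)

lemma sub2_feasible_iff:
  assumes "xu \<in> Rplus" "yu \<in> Zplus"
  shows "(xl, yl) \<in> sub2_feasible D xu yu \<theta> \<longleftrightarrow>
    (xu, yu, xl, yl) \<in> Omega D \<and> \<theta> \<le> lower_obj D (xl, yl)"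
  using assms by (auto simp: Omega_iff sub2_feasible_def lower_feasible_def lower_obj_def)

section \<open>Solvability of the subproblems\<close>

lemma closed_Collect_le_vec:
  fixes f g :: "'a::topological_space \<Rightarrow> real^'n"
  assumes "continuous_on UNIV f" "continuous_on UNIV g"
  shows "closed {z. f z \<le> g z}"
  unfolding less_eq_vec_def
  by (intro closed_Collect_all closed_Collect_le continuous_intros assms)

lemma closed_Zplus: "closed (Zplus :: (real^'n) set)"
proof -
  have "closed ((\<lambda>y::real^'n. y $ i) -` \<int>)" for i
    by (intro closed_vimage closed_Ints continuous_intros)
  then have "closed {y::real^'n. 0 \<le> y \<and> (\<forall>i. y $ i \<in> \<int>)}"
    by (intro closed_Collect_conj closed_Collect_all closed_Collect_le_vec continuous_intros)
      (simp add: vimage_def)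
  then show ?thesis
    by (simp add: Zplus_def)
qed

lemma continuous_on_matrix_vector [continuous_intros]:
  fixes A :: "real^'n^'m"
  shows "continuous_on S f \<Longrightarrow> continuous_on S (\<lambda>z. A *v f z)"
  by (rule bounded_linear.continuous_on[OF matrix_vector_mul_bounded_linear])

text \<open>
  The bounds on the variables apply to the lower-level problem only at upper-level decisions that
  occur in \<open>Omega D\<close>; this is why a point of \<open>Omega D\<close> is assumed here and below.
\<close>

lemma compact_lower_feasible:
  assumes "all_variables_bounded D" and "(xu, yu, xl0, yl0) \<in> Omega D"
  shows "compact (lower_feasible D xu yu)"
proof -
  obtain bxl byl where
    "\<And>xl yl. (xl, yl) \<in> lower_feasible D xu yu \<Longrightarrow> xl \<le> bxl \<and> yl \<le> byl"
    using assms unfolding all_variables_bounded_def by blast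
  then have "lower_feasible D xu yu \<subseteq> {0..bxl} \<times> {0..byl}"
    by (auto simp: lower_feasible_def Rplus_def Zplus_def)
  moreover have "compact ({0..bxl} \<times> {0..byl})"
    by (intro compact_Times compact_interval)
  moreover have "closed (lower_feasible D xu yu)"
  proof -
    have "lower_feasible D xu yu = {z. 0 \<le> fst z} \<inter> snd -` Zplus \<inter>
        {z. P_R D *v fst z + P_Z D *v snd z \<le> rhs_s D - Q_R D *v xu - Q_Z D *v yu}"
      by (auto simp: lower_feasible_def Rplus_def)
    also have "closed \<dots>"
      by (intro closed_Int closed_vimage closed_Zplus closed_Collect_le_vec continuous_intros)
    finally show ?thesis .
  qed
  ultimately show ?thesis
    using compact_Int_closed by (metis inf.absorb2)
qed

lemma continuous_on_lower_obj: "continuous_on S (lower_obj D)"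
  unfolding lower_obj_def case_prod_unfold by (intro continuous_intros)

lemma lower_optimal_exists:
  assumes "all_variables_bounded D" and "(xu, yu, xl0, yl0) \<in> Omega D"
  shows "\<exists>xl yl. lower_optimal D xu yu (xl, yl)"
proof -
  have "lower_feasible D xu yu \<noteq> {}"
    using Omega_signs[OF assms(2)] by blast
  then obtain z where "z \<in> lower_feasible D xu yu"
    "\<forall>z'\<in>lower_feasible D xu yu. lower_obj D z' \<le> lower_obj D z"
    using continuous_attains_sup[OF compact_lower_feasible[OF assms] _ continuous_on_lower_obj]
    by blast
  then have "lower_optimal D xu yu z"
    by (auto simp: lower_optimal_def is_arg_max_linorder)
  then show ?thesis
    by (cases z) blast
qed

lemma sub2_optimal_exists:
  assumes bdd: "all_variables_bounded D" and om: "(xu, yu, xl0, yl0) \<in> Omega D"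
    and ne: "sub2_feasible D xu yu \<theta> \<noteq> {}"
  shows "\<exists>xl yl. sub2_optimal D xu yu \<theta> (xl, yl)"
proof -
  have "sub2_feasible D xu yu \<theta> = lower_feasible D xu yu \<inter>
      ({z. B_R D *v fst z + B_Z D *v snd z \<le> rhs_r D - A_R D *v xu - A_Z D *v yu} \<inter>
       {z. \<theta> \<le> lower_obj D z})"
    by (auto simp: sub2_feasible_def lower_feasible_def lower_obj_def)
  also have "compact \<dots>"
    by (intro compact_Int_closed compact_lower_feasible[OF bdd om] closed_Int closed_Collect_le_vec
        closed_Collect_le continuous_intros continuous_on_lower_obj)
  finally have "compact (sub2_feasible D xu yu \<theta>)" .
  moreover have "continuous_on (sub2_feasible D xu yu \<theta>)
      (\<lambda>(xl, yl). d_R D \<bullet> xl + d_Z D \<bullet> yl)"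
    unfolding case_prod_unfold by (intro continuous_intros)
  ultimately obtain z where "z \<in> sub2_feasible D xu yu \<theta>"
    "\<forall>z'\<in>sub2_feasible D xu yu \<theta>. (\<lambda>(xl, yl). d_R D \<bullet> xl + d_Z D \<bullet> yl) z \<le>
       (\<lambda>(xl, yl). d_R D \<bullet> xl + d_Z D \<bullet> yl) z'"
    using continuous_attains_inf[OF _ ne] by blast
  then have "sub2_optimal D xu yu \<theta> z"
    unfolding sub2_optimal_def is_arg_min_linorder by blast
  then show ?thesis
    by (cases z) blast
qed

section \<open>Relaxation and exactness of the cuts\<close>

text \<open>
  With the integer part fixed to \<open>y\<close>, the lower-level problem is a linear program over a compact
  set, so it has an optimal solution, and strong duality supplies the multipliers.
\<close>

lemma lower_slice_KKT:
  assumes bdd: "all_variables_bounded D" and om: "(xu, yu, xl0, yl0) \<in> Omega D"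
    and feas: "(xl, y) \<in> lower_feasible D xu yu"
  shows "\<exists>x \<pi>. KKT (P_R D) (rhs_s D - Q_R D *v xu - Q_Z D *v yu - P_Z D *v y) (w_R D) x \<pi>"
proof -
  let ?K = "lower_feasible D xu yu \<inter> UNIV \<times> {y}"
  have K: "compact ?K"
    by (intro compact_Int_closed compact_lower_feasible[OF bdd om] closed_Times) auto
  have "?K \<noteq> {}"
    using feas by blast
  from continuous_attains_sup[OF K this continuous_on_lower_obj]
  obtain z where z: "z \<in> ?K" "\<And>z'. z' \<in> ?K \<Longrightarrow> lower_obj D z' \<le> lower_obj D z"
    by blast
  obtain x where x: "z = (x, y)"
    using z(1) by auto
  have y: "y \<in> Zplus"
    using feas by (simp add: lower_feasible_iff)
  have opt: "w_R D \<bullet> x' \<le> w_R D \<bullet> x" if "0 \<le> x'"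
    and "P_R D *v x' \<le> rhs_s D - Q_R D *v xu - Q_Z D *v yu - P_Z D *v y" for x'
    using z(2)[of "(x', y)"] that y by (simp add: x lower_feasible_iff lower_obj_def)
  have "0 \<le> x" "P_R D *v x \<le> rhs_s D - Q_R D *v xu - Q_Z D *v yu - P_Z D *v y"
    using z(1) by (auto simp: x lower_feasible_iff)
  then show ?thesis
    using optimal_imp_KKT[OF _ _ opt] by blast
qed

text \<open>
  The master problem is a relaxation: choosing for every \<open>y\<close> an optimal solution and a multiplier of
  the corresponding linear program satisfies all cuts, since a follower optimum is at
  least as good as every \<open>(xj y, y)\<close>.
\<close>

lemma IR_extends_to_master:
  assumes bdd: "all_variables_bounded D" and Ys: "Ys \<subseteq> YL D" and p: "p \<in> IR D"
  shows "\<exists>xj \<pi>. (p, xj, \<pi>) \<in> master_feasible D Ys"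
proof -
  obtain xu yu xl0 yl0 where p_eq: "p = (xu, yu, xl0, yl0)"
    by (cases p)
  have om: "(xu, yu, xl0, yl0) \<in> Omega D" and lo: "lower_optimal D xu yu (xl0, yl0)"
    using p by (auto simp: IR_def p_eq)
  let ?b = "\<lambda>y. rhs_s D - Q_R D *v xu - Q_Z D *v yu - P_Z D *v y"
  have "\<exists>x\<pi>. KKT (P_R D) (?b y) (w_R D) (fst x\<pi>) (snd x\<pi>)"
    if y: "y \<in> Ys" "(xu, yu) \<in> Proj_P D y" for y
  proof -
    have "y \<in> Zplus"
      using y(1) Ys YL_subset_Zplus by blast
    then obtain xl where "(xl, y) \<in> lower_feasible D xu yu"
      using y(2) Proj_P_iff[OF Omega_signs(1,2)[OF om]] by blast
    from lower_slice_KKT[OF bdd om this] show ?thesis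
      by simp
  qed
  then obtain f where f: "\<And>y. y \<in> Ys \<Longrightarrow> (xu, yu) \<in> Proj_P D y \<Longrightarrow>
      KKT (P_R D) (?b y) (w_R D) (fst (f y)) (snd (f y))"
    by metis
  have "lower_obj D (fst (f y), y) \<le> lower_obj D (xl0, yl0)"
    if y: "y \<in> Ys" "(xu, yu) \<in> Proj_P D y" for y
  proof -
    have "(fst (f y), y) \<in> lower_feasible D xu yu"
      using f[OF y] y Ys YL_subset_Zplus by (auto simp: lower_feasible_iff KKT_def)
    then show ?thesis
      using lo by (auto simp: lower_optimal_def is_arg_max_linorder)
  qed
  then have "(p, \<lambda>y. fst (f y), \<lambda>y. snd (f y)) \<in> master_feasible D Ys"
    using om f by (simp add: p_eq master_feasible_iff)
  then show ?thesis
    by blast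
qed

lemma master_optimal_le:
  assumes "all_variables_bounded D" and "master_optimal D Ys (p, xj, \<pi>)" and "q \<in> IR D"
  shows "upper_obj D p \<le> upper_obj D q"
proof -
  have "Ys \<subseteq> YL D"
    using assms(2) by (simp add: master_optimal_def)
  then obtain xj' \<pi>' where "(q, xj', \<pi>') \<in> master_feasible D Ys"
    using IR_extends_to_master[OF assms(1) _ assms(3)] by blast
  moreover have "\<forall>z\<in>master_feasible D Ys. upper_obj D p \<le> upper_obj D (fst z)"
    using assms(2) by (simp add: master_optimal_def is_arg_min_linorder Ball_def
        del: split_paired_All)
  ultimately show ?thesis
    by fastforce
qed

text \<open>
  The cuts are exact. The complementarity system forces \<open>xj y\<close> to be a best response with integer
  part \<open>y\<close>, so the cut compares the master solution with all responses of that kind.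
\<close>

lemma master_cut:
  assumes "((xu, yu, xl0, yl0), xj, \<pi>) \<in> master_feasible D Ys"
    and "y \<in> Ys" and "(xl, y) \<in> lower_feasible D xu yu"
  shows "lower_obj D (xl, y) \<le> lower_obj D (xl0, yl0)"
proof -
  have om: "(xu, yu, xl0, yl0) \<in> Omega D"
    using assms(1) by (simp add: master_feasible_iff)
  have "(xu, yu) \<in> Proj_P D y"
    using Omega_signs[OF om] assms(3) by (auto simp: Proj_P_iff lower_feasible_iff)
  then have cut: "lower_obj D (xj y, y) \<le> lower_obj D (xl0, yl0)"
    and kkt: "KKT (P_R D) (rhs_s D - Q_R D *v xu - Q_Z D *v yu - P_Z D *v y) (w_R D) (xj y) (\<pi> y)"
    using assms(1,2) by (auto simp: master_feasible_iff)
  have "w_R D \<bullet> xl \<le> w_R D \<bullet> xj y"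
    using KKT_imp_optimal[OF kkt] assms(3) by (simp add: lower_feasible_iff)
  with cut show ?thesis
    by (simp add: lower_obj_def)
qed

text \<open>
  The constraint on the follower value in the second subproblem leaves only follower optima, so the
  values that enter the upper bound are attained in the inducible region.
\<close>

lemma sub2_feasible_imp_IR:
  assumes "xu \<in> Rplus" "yu \<in> Zplus" "lower_optimal D xu yu z"
    and "(xl, yl) \<in> sub2_feasible D xu yu (lower_obj D z)"
  shows "(xu, yu, xl, yl) \<in> IR D"
proof -
  have om: "(xu, yu, xl, yl) \<in> Omega D" and ge: "lower_obj D z \<le> lower_obj D (xl, yl)"
    using assms(4) by (simp_all add: sub2_feasible_iff[OF assms(1,2)])
  have "lower_optimal D xu yu (xl, yl)"
    using assms(3) ge Omega_signs(4)[OF om]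
    by (fastforce simp: lower_optimal_def is_arg_max_linorder)
  with om show ?thesis
    by (simp add: IR_def)
qed

section \<open>The invariant of the algorithm\<close>

definition incumbent where
  "incumbent D s \<longleftrightarrow> upper_bd s = \<infinity> \<or> (\<exists>p\<in>IR D. upper_bd s = ereal (upper_obj D p))"

definition master_solved where
  "master_solved D s \<longleftrightarrow> (\<exists>xj \<pi>.
     master_optimal D (Y_under s) ((xu_star s, yu_star s, xl0_star s, yl0_star s), xj, \<pi>)) \<and>
     lower_bd s = ereal (upper_obj D (xu_star s, yu_star s, xl0_star s, yl0_star s))"

definition relaxation_bound where
  "relaxation_bound D s \<longleftrightarrow>
     (\<exists>r. lower_bd s = ereal r \<and> (\<forall>q\<in>IR D. r \<le> upper_obj D q))"

text \<open>
  The stopping test for tolerance zero.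
\<close>

definition gap_closed where
  "gap_closed s \<longleftrightarrow> upper_bd s - lower_bd s \<le> 0"

text \<open>
  While the algorithm runs, \<open>iter\<close> counts the elements of \<open>Y_under\<close>: every iteration has added a
  new one. This can fail only in \<open>Step7\<close>, after a repeated vector was added, and then the gap is
  closed and the algorithm stops. In \<open>Step7\<close> the current master solution is no longer known to
  satisfy the new cut, and \<open>Y_under\<close> may have left \<open>YL D\<close>; what remains is the bound that the
  solution gave, and a bound on \<open>iter\<close> that is larger by one.
\<close>

definition alg_invariant where
  "alg_invariant D s \<longleftrightarrow> finite (Y_under s) \<and> incumbent D s \<and>
     (case ctrl s of
        Step2 \<Rightarrow> iter s = card (Y_under s)
      | Step3 \<Rightarrow> iter s = card (Y_under s) \<and> master_solved D s
      | Step4 \<Rightarrow> iter s = card (Y_under s) \<and> master_solved D s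
      | Step5 \<Rightarrow> iter s = card (Y_under s) \<and> master_solved D s \<and>
          (\<exists>xl. lower_optimal D (xu_star s) (yu_star s) (xl, y_hat s) \<and>
                theta s = lower_obj D (xl, y_hat s))
      | Step6 \<Rightarrow> iter s = card (Y_under s) \<and> master_solved D s \<and>
          (y_tilde s \<in> Y_under s \<longrightarrow> gap_closed s)
      | Step7 \<Rightarrow> iter s \<le> Suc (card (YL D)) \<and> relaxation_bound D s \<and>
          (gap_closed s \<or> iter s = card (Y_under s))
      | Terminated \<Rightarrow> relaxation_bound D s \<and> gap_closed s)"

lemma gap_closedI:
  assumes "lower_bd s = ereal r" "upper_bd s \<le> ereal r"
  shows "gap_closed s"
  using assms by (cases "upper_bd s") (auto simp: gap_closed_def zero_ereal_def)

lemma master_solvedD: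
  assumes "master_solved D s"
  shows "Y_under s \<subseteq> YL D"
    and "(xu_star s, yu_star s, xl0_star s, yl0_star s) \<in> Omega D"
    and "\<exists>xj \<pi>. ((xu_star s, yu_star s, xl0_star s, yl0_star s), xj, \<pi>)
           \<in> master_feasible D (Y_under s)"
  using assms
  by (auto simp: master_solved_def master_optimal_def is_arg_min_def master_feasible_iff)

lemma master_solved_imp_relaxation_bound:
  assumes "all_variables_bounded D" and "master_solved D s"
  shows "relaxation_bound D s"
  using assms master_optimal_le unfolding master_solved_def relaxation_bound_def by blast

text \<open>
  The heart of the termination argument: if a response of value at least \<open>\<theta>\<close> uses an integer
  vector whose cut is already present, the master solution is itself a response of value at least
  \<open>\<theta>\<close>, and it satisfies the upper-level constraints.
\<close>

lemma repeated_cut_feasible: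
  assumes solved: "master_solved D s"
    and y: "y \<in> Y_under s"
    and feas: "(xl, y) \<in> lower_feasible D (xu_star s) (yu_star s)"
    and ge: "\<theta> \<le> lower_obj D (xl, y)"
  shows "(xl0_star s, yl0_star s) \<in> sub2_feasible D (xu_star s) (yu_star s) \<theta>"
proof -
  note om = master_solvedD(2)[OF solved]
  have "lower_obj D (xl, y) \<le> lower_obj D (xl0_star s, yl0_star s)"
    using master_solvedD(3)[OF solved] master_cut y feas by blast
  then show ?thesis
    using om ge Omega_signs[OF om] by (simp add: sub2_feasible_iff)
qed

text \<open>
  The second subproblem is the decisive step. If its solution repeats a vector of \<open>Y_under\<close>, the
  master solution competes in it, so its value, and with it the new upper bound, is at most the lower
  bound. If it is infeasible, the vector found by the first subproblem cannot be a repetition, as the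
  master solution would then be feasible.
\<close>

lemma alg_step_invariant:
  assumes bdd: "all_variables_bounded D" and fin: "finite (YL D)"
    and inv: "alg_invariant D s" and step: "alg_step D 0 s t"
  shows "alg_invariant D t"
  using step
proof cases
  case (solve_master xu yu xl0 yl0 xj \<pi>)
  then show ?thesis
    using inv by (auto simp: alg_invariant_def incumbent_def master_solved_def)
next
  case stop3
  then show ?thesis
    using inv master_solved_imp_relaxation_bound[OF bdd, of s]
    by (auto simp: alg_invariant_def incumbent_def relaxation_bound_def gap_closed_def zero_ereal_def)
next
  case continue3
  then show ?thesis
    using inv by (auto simp: alg_invariant_def incumbent_def master_solved_def)
next
  case (subproblem1 xl yl)
  then show ?thesis
    using inv by (auto simp: alg_invariant_def incumbent_def master_solved_def)
next
  case (subproblem2_feasible xl yl)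
  have solved: "master_solved D s" and card: "iter s = card (Y_under s)"
    and fY: "finite (Y_under s)" and inc: "incumbent D s"
    using inv subproblem2_feasible by (auto simp: alg_invariant_def)
  obtain xh where xh: "lower_optimal D (xu_star s) (yu_star s) (xh, y_hat s)"
    and th: "theta s = lower_obj D (xh, y_hat s)"
    using inv subproblem2_feasible by (auto simp: alg_invariant_def)
  note om = master_solvedD(2)[OF solved]
  note signs = Omega_signs(1,2)[OF om]
  let ?p = "(xu_star s, yu_star s, xl, yl)"
  have z: "(xl, yl) \<in> sub2_feasible D (xu_star s) (yu_star s) (theta s)"
    and zmin: "\<And>z. z \<in> sub2_feasible D (xu_star s) (yu_star s) (theta s) \<Longrightarrow>
      d_R D \<bullet> xl + d_Z D \<bullet> yl \<le> d_R D \<bullet> fst z + d_Z D \<bullet> snd z"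
    using subproblem2_feasible(3)
    by (auto simp: sub2_optimal_def is_arg_min_linorder case_prod_unfold)
  have "?p \<in> IR D"
    using sub2_feasible_imp_IR[OF signs xh] z th by simp
  moreover have ub: "upper_bd t = min (upper_bd s) (ereal (upper_obj D ?p))"
    using subproblem2_feasible(1) by (simp add: upper_obj_def algebra_simps)
  ultimately have inc': "incumbent D t"
    using inc by (auto simp: incumbent_def min_def)
  have "gap_closed t" if rep: "yl \<in> Y_under s"
  proof -
    have "(xl0_star s, yl0_star s) \<in> sub2_feasible D (xu_star s) (yu_star s) (theta s)"
      using repeated_cut_feasible[OF solved rep, of xl "theta s"] z
      by (simp add: sub2_feasible_iff[OF signs] Omega_iff[OF signs])
    from zmin[OF this]
    have "upper_obj D ?p \<le> upper_obj D (xu_star s, yu_star s, xl0_star s, yl0_star s)"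
      by (simp add: upper_obj_def)
    then show ?thesis
      using solved subproblem2_feasible(1) ub
      by (intro gap_closedI) (auto simp: master_solved_def intro: min.coboundedI2)
  qed
  then show ?thesis
    using subproblem2_feasible(1) inc' solved card fY
    by (auto simp: alg_invariant_def master_solved_def)
next
  case subproblem2_infeasible
  have solved: "master_solved D s"
    using inv subproblem2_infeasible by (auto simp: alg_invariant_def)
  obtain xh where xh: "lower_optimal D (xu_star s) (yu_star s) (xh, y_hat s)"
    and th: "theta s = lower_obj D (xh, y_hat s)"
    using inv subproblem2_infeasible by (auto simp: alg_invariant_def)
  have "y_hat s \<notin> Y_under s"
    using repeated_cut_feasible[OF solved, of "y_hat s" xh "theta s"] xh th
      subproblem2_infeasible(3)
    by (auto simp: lower_optimal_def is_arg_max_def)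
  then show ?thesis
    using inv subproblem2_infeasible
    by (auto simp: alg_invariant_def incumbent_def master_solved_def)
next
  case tighten
  have solved: "master_solved D s" and card: "iter s = card (Y_under s)"
    and fY: "finite (Y_under s)" and inc: "incumbent D s"
    and fresh: "y_tilde s \<in> Y_under s \<longrightarrow> gap_closed s"
    using inv tighten by (auto simp: alg_invariant_def)
  have "iter s \<le> card (YL D)"
    using card card_mono[OF fin master_solvedD(1)[OF solved]] by simp
  then show ?thesis
    using tighten card fY inc fresh master_solved_imp_relaxation_bound[OF bdd solved]
    by (auto simp: alg_invariant_def incumbent_def relaxation_bound_def gap_closed_def)
next
  case stop7
  then show ?thesis
    using inv
    by (auto simp: alg_invariant_def incumbent_def relaxation_bound_def gap_closed_def zero_ereal_def)
next
  case loop7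
  then show ?thesis
    using inv by (auto simp: alg_invariant_def incumbent_def gap_closed_def zero_ereal_def)
qed

section \<open>Termination and optimality\<close>

lemma alg_step_exists:
  assumes bdd: "all_variables_bounded D" and inv: "alg_invariant D s"
    and master: "ctrl s = Step2 \<Longrightarrow> \<exists>z. master_optimal D (Y_under s) z"
    and running: "ctrl s \<noteq> Terminated"
  shows "\<exists>t. alg_step D \<xi> s t"
proof (cases "ctrl s")
  case Step2
  then obtain xu yu xl0 yl0 xj \<pi> where
    "master_optimal D (Y_under s) ((xu, yu, xl0, yl0), xj, \<pi>)"
    using master by (metis prod.exhaust)
  from alg_step.solve_master[OF Step2 this] show ?thesis
    by blast
next
  case Step3
  then show ?thesis
    using alg_step.stop3 alg_step.continue3 by blast
next
  case Step4
  then have "master_solved D s"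
    using inv by (simp add: alg_invariant_def)
  then show ?thesis
    using lower_optimal_exists[OF bdd master_solvedD(2)] alg_step.subproblem1[OF Step4] by blast
next
  case Step5
  then have "master_solved D s"
    using inv by (simp add: alg_invariant_def)
  then show ?thesis
    using sub2_optimal_exists[OF bdd master_solvedD(2)]
      alg_step.subproblem2_feasible[OF Step5] alg_step.subproblem2_infeasible[OF Step5] by blast
next
  case Step6
  then show ?thesis
    using alg_step.tighten by blast
next
  case Step7
  then show ?thesis
    using alg_step.stop7 alg_step.loop7 by blast
next
  case Terminated
  then show ?thesis
    using running by simp
qed

text \<open>
  One iteration consists of six steps, and \<open>iter\<close> is incremented on entry to \<open>Step7\<close>; numbering the
  steps from there makes \<open>progress\<close> grow by exactly one per step. The value in the terminated state is
  arbitrary.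
\<close>

definition progress where
  "progress s = 6 * iter s +
     (case ctrl s of Step7 \<Rightarrow> 0 | Step2 \<Rightarrow> 1 | Step3 \<Rightarrow> 2 | Step4 \<Rightarrow> 3
        | Step5 \<Rightarrow> 4 | Step6 \<Rightarrow> 5 | Terminated \<Rightarrow> 0)"

lemma alg_step_progress:
  assumes "alg_step D \<xi> s t" and "ctrl t \<noteq> Terminated"
  shows "progress t = Suc (progress s)"
  using assms by cases (auto simp: progress_def)

text \<open>
  From \<open>Step2\<close> to \<open>Step6\<close> the vectors counted by \<open>iter\<close> all belong to \<open>YL D\<close>. In \<open>Step7\<close> the count may
  exceed \<open>card (YL D)\<close> by one, which accounts for the last summand.
\<close>

lemma progress_bound:
  assumes fin: "finite (YL D)" and inv: "alg_invariant D s"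
    and running: "ctrl s \<noteq> Terminated"
    and master: "ctrl s = Step2 \<Longrightarrow> Y_under s \<subseteq> YL D"
  shows "progress s \<le> 6 * card (YL D) + 6"
proof (cases "ctrl s = Step7")
  case True
  then show ?thesis
    using inv by (simp add: alg_invariant_def progress_def)
next
  case False
  then have "iter s = card (Y_under s)" and "ctrl s = Step2 \<or> master_solved D s"
    using inv running by (auto simp: alg_invariant_def split: control.splits)
  then have "iter s \<le> card (YL D)"
    using card_mono[OF fin] master master_solvedD(1) by metis
  then show ?thesis
    by (simp add: progress_def split: control.splits)
qed

text \<open>
  The closed gap excludes an infinite upper bound, so an incumbent in the inducible region exists; its
  value is at most the lower bound, which no point of the inducible region undercuts.
\<close>

lemma terminated_imp_bilevel_optimal:
  assumes "alg_invariant D s" and "ctrl s = Terminated"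
  shows "\<exists>p. bilevel_optimal D p \<and> lower_bd s = ereal (upper_obj D p) \<and>
    upper_bd s = ereal (upper_obj D p)"
proof -
  obtain r where r: "lower_bd s = ereal r" "\<And>q. q \<in> IR D \<Longrightarrow> r \<le> upper_obj D q"
    and gap: "upper_bd s - lower_bd s \<le> 0" and inc: "incumbent D s"
    using assms by (auto simp: alg_invariant_def relaxation_bound_def gap_closed_def)
  obtain p where p: "p \<in> IR D" "upper_bd s = ereal (upper_obj D p)"
    using inc gap r(1) by (auto simp: incumbent_def)
  have "upper_obj D p = r"
    using gap r(2)[OF p(1)] by (simp add: p r zero_ereal_def)
  moreover from this have "bilevel_optimal D p"
    using p r by (auto simp: bilevel_optimal_def is_arg_min_linorder)
  ultimately show ?thesis
    using p r by blast
qed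

theorem theorem2:
  fixes D :: "('mr::finite, 'mz::finite, 'nr::finite, 'nz::finite, 'nu::finite, 'nl::finite) miblp"
    and \<xi> :: real
    and st :: "nat \<Rightarrow> ('mr, 'mz, 'nr, 'nz) alg_state"
  assumes "IR D \<noteq> {}"
    and "all_variables_bounded D"
    and "\<xi> = 0"
    and "finite (YL D)"
    and "alg_run D \<xi> st"
    and master_solvable: "\<And>n. ctrl (st n) = Step2 \<Longrightarrow> \<exists>z. master_optimal D (Y_under (st n)) z"
  shows "(\<exists>n. ctrl (st n) = Terminated \<and>
            (\<exists>p. bilevel_optimal D p \<and>
                 lower_bd (st n) = ereal (upper_obj D p) \<and>
                 upper_bd (st n) = ereal (upper_obj D p))) \<and>
         (\<forall>n. ctrl (st n) = Step2 \<longrightarrow> iter (st n) \<le> card (YL D))"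
proof -
  note bdd = \<open>all_variables_bounded D\<close> and fin = \<open>finite (YL D)\<close>
  have init: "initial_state (st 0)"
    and run: "\<And>n. alg_step D 0 (st n) (st (Suc n)) \<or>
      (\<nexists>t. alg_step D 0 (st n) t) \<and> st (Suc n) = st n"
    using \<open>alg_run D \<xi> st\<close> \<open>\<xi> = 0\<close> by (auto simp: alg_run_def)
  have inv: "alg_invariant D (st n)" for n
  proof (induction n)
    case 0
    then show ?case
      using init by (simp add: initial_state_def alg_invariant_def incumbent_def)
  next
    case (Suc n)
    then show ?case
      using run[of n] alg_step_invariant[OF bdd fin] by metis
  qed
  have sub: "Y_under (st n) \<subseteq> YL D" if "ctrl (st n) = Step2" for n
    using master_solvable[OF that] by (auto simp: master_optimal_def)
  have "\<exists>n. ctrl (st n) = Terminated"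
  proof (rule ccontr)
    assume "\<nexists>n. ctrl (st n) = Terminated"
    then have running: "ctrl (st n) \<noteq> Terminated" for n
      by blast
    have step: "alg_step D 0 (st n) (st (Suc n))" for n
      using run[of n] alg_step_exists[OF bdd inv master_solvable running] by blast
    have "progress (st n) = Suc n" for n
    proof (induction n)
      case 0
      then show ?case
        using init by (simp add: initial_state_def progress_def)
    next
      case (Suc n)
      then show ?case
        using alg_step_progress[OF step running] by simp
    qed
    then show False
      using progress_bound[OF fin inv running sub, of "6 * card (YL D) + 6"] by simp
  qed
  moreover have "iter (st n) \<le> card (YL D)" if "ctrl (st n) = Step2" for n
    using inv[of n] card_mono[OF fin sub[OF that]] that by (simp add: alg_invariant_def)
  ultimately show ?thesis
    using terminated_imp_bilevel_optimal[OF inv] by blast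
qed

end
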